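(* Let $\lambda\leq\Omega$ be a limit ordinal and let $\mathfrak F'=(f_\eta)_{\eta<\lambda}$ be a sequence of functions with properties (1)–(3) of the context. Then $\lambda<\Omega$.
   Context: $\Omega=\omega_1$. Each $f_\eta$ is a strictly increasing function from the positive integers $\{1,2,3,\dots\}$ to the positive integers; $Vf$ denotes the range of $f$, and $f^2=f\circ f$. For ordinals $\alpha<\beta<\lambda$, write $\alpha\to\beta$ if $Vf_\zeta\subseteq Vf_\alpha$ for all $\zeta$ with $\alpha<\zeta\leq\beta$. Properties, for all $\eta<\lambda$: (1) $f_0(x)=2^x$. (2) If $\eta=\eta'+1$ then $f_\eta=f_{\eta'}^2$. (3) If $\eta$ is a limit ordinal, then $\eta$ is assigned a strictly increasing sequence $(\eta_x)_{x<\omega}$ with supremum $\eta$, such that $\eta_x+1\to\eta_{x+1}$ for all $x<\omega$, and $f_\eta(x)=f_{\eta_x}(1)$ for all $x\geq1$. *)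

theory Defs
  imports Main
begin

unbundle cardinal_syntax

text \<open>
  An ordinal \<open>\<lambda>\<close> is represented by a well-order \<open>r\<close> (non-strict, as in the library) of that
  order type; the ordinals below \<open>\<lambda>\<close> are the elements of \<^term>\<open>Field r\<close>. Ordinals are compared
  by \<open>\<le>o\<close> and \<open><o\<close>.
\<close>

definition Omega1 :: "nat set rel" where
  "Omega1 = cardSuc natLeq"

definition limit_ordinal :: "'a rel \<Rightarrow> bool" where
  "limit_ordinal r \<longleftrightarrow>
     Well_order r \<and> Field r \<noteq> {} \<and> (\<forall>\<alpha> \<in> Field r. aboveS r \<alpha> \<noteq> {})"

definition ord_zero :: "'a rel \<Rightarrow> 'a" where
  "ord_zero r = wo_rel.minim r (Field r)"

definition ord_succ :: "'a rel \<Rightarrow> 'a \<Rightarrow> 'a" where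
  "ord_succ r \<alpha> = wo_rel.suc r {\<alpha>}"

text \<open>
  The condition \<open>aboveS r \<alpha> \<noteq> {}\<close> excludes a greatest element \<open>\<alpha>\<close>, whose \<^const>\<open>ord_succ\<close>
  is unspecified.
\<close>

definition limit_below :: "'a rel \<Rightarrow> 'a \<Rightarrow> bool" where
  "limit_below r \<eta> \<longleftrightarrow> \<eta> \<in> Field r \<and> \<eta> \<noteq> ord_zero r \<and>
     (\<nexists>\<alpha>. \<alpha> \<in> Field r \<and> aboveS r \<alpha> \<noteq> {} \<and> \<eta> = ord_succ r \<alpha>)"

definition seq_with_sup :: "'a rel \<Rightarrow> (nat \<Rightarrow> 'a) \<Rightarrow> 'a \<Rightarrow> bool" where
  "seq_with_sup r e \<eta> \<longleftrightarrow>
     (\<forall>x. e x \<in> Field r) \<and> (\<forall>x y. x < y \<longrightarrow> e x \<in> underS r (e y)) \<and>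
     wo_rel.isMinim r (Above r (range e)) \<eta>"

text \<open>
  Functions on the positive integers are functions on \<^typ>\<open>nat\<close> whose value at \<open>0\<close> is ignored.
\<close>

definition pos_range :: "(nat \<Rightarrow> nat) \<Rightarrow> nat set" where
  "pos_range g = g ` {1..}"

definition pos_strict_mono :: "(nat \<Rightarrow> nat) \<Rightarrow> bool" where
  "pos_strict_mono g \<longleftrightarrow> pos_range g \<subseteq> {1..} \<and> strict_mono_on {1..} g"

text \<open>
  The relation \<open>\<alpha> \<rightarrow> \<beta>\<close>, meant for \<open>\<alpha> < \<beta>\<close>. For \<open>\<alpha> = \<beta>\<close> it holds vacuously, so that the
  condition \<open>\<eta>\<^sub>x + 1 \<rightarrow> \<eta>\<^sub>x\<^sub>+\<^sub>1\<close> below admits \<open>\<eta>\<^sub>x\<^sub>+\<^sub>1 = \<eta>\<^sub>x + 1\<close>, as for \<open>\<eta> = \<omega>\<close>, \<open>\<eta>\<^sub>x = x\<close>.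
\<close>

definition arrow :: "'a rel \<Rightarrow> ('a \<Rightarrow> nat \<Rightarrow> nat) \<Rightarrow> 'a \<Rightarrow> 'a \<Rightarrow> bool" where
  "arrow r f \<alpha> \<beta> \<longleftrightarrow>
     (\<forall>\<zeta> \<in> aboveS r \<alpha> \<inter> under r \<beta>. pos_range (f \<zeta>) \<subseteq> pos_range (f \<alpha>))"

end

theory Submission
  imports Defs "HOL-Library.Countable_Set_Type"
begin

text \<open>
  If \<open>\<eta>\<close> and \<open>\<theta>\<close> are limits with \<open>\<eta>\<^sub>n = \<theta>\<^sub>n = \<alpha>\<close>, then \<open>\<theta>\<^sub>n\<^sub>+\<^sub>1 < \<eta>\<close>. Otherwise
  \<open>\<alpha> + 1 < \<eta> \<le> \<theta>\<^sub>n\<^sub>+\<^sub>1\<close>, and \<open>\<alpha> + 1 \<rightarrow> \<theta>\<^sub>n\<^sub>+\<^sub>1\<close> puts the value \<open>f\<^sub>\<eta>(n) = f\<^sub>\<alpha>(1)\<close> into the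
  range of \<open>f\<^sub>\<alpha>\<^sub>+\<^sub>1\<close>, whose least element \<open>f\<^sub>\<alpha>(f\<^sub>\<alpha>(1))\<close> is larger.

  Suppose \<open>\<lambda> = \<Omega>\<close> and fix \<open>\<alpha>\<close>. By the above and induction on \<open>n\<close>, the \<open>\<eta>\<^sub>n\<close> with \<open>\<eta>\<^sub>1 = \<alpha>\<close>
  form a countable set for every \<open>n \<ge> 1\<close>; hence the limits \<open>\<eta>\<close> with \<open>\<eta>\<^sub>1 = \<alpha>\<close> are bounded below
  \<open>\<Omega>\<close>. Closing off under these bounds yields a limit \<open>\<delta>\<close> such that \<open>\<eta>\<^sub>1 < \<delta>\<close> implies
  \<open>\<eta> < \<delta>\<close> for all limits \<open>\<eta>\<close>, which is absurd for \<open>\<eta> = \<delta>\<close>.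
\<close>

section \<open>Countable sets of ordinals below \<Omega>\<close>

lemma Omega1_countable_underS:
  assumes "r =o Omega1" "a \<in> Field r"
  shows "countable (underS r a)"
proof -
  have "Card_order r"
    using assms(1) Card_order_ordIso cardSuc_Card_order natLeq_Card_order
    unfolding Omega1_def by blast
  then have "|underS r a| <o cardSuc natLeq"
    using ordLess_ordIso_trans[OF card_of_underS[OF _ assms(2)] assms(1)]
    unfolding Omega1_def by simp
  then have "|underS r a| \<le>o natLeq"
    using cardSuc_ordLeq_ordLess[OF natLeq_Card_order card_of_Card_order] by blast
  then show ?thesis
    by (simp add: countable_card_le_natLeq)
qed

lemma Omega1_uncountable_Field:
  assumes "r =o Omega1"
  shows "uncountable (Field r)"
proof
  assume "countable (Field r)"
  then have le: "|Field r| \<le>o natLeq"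
    by (simp add: countable_card_le_natLeq)
  have "Card_order r"
    using assms Card_order_ordIso cardSuc_Card_order natLeq_Card_order
    unfolding Omega1_def by blast
  then have "r \<le>o natLeq"
    using le card_of_Field_ordIso ordIso_ordLeq_trans ordIso_symmetric by blast
  then have "cardSuc natLeq \<le>o natLeq"
    using assms ordIso_ordLeq_trans ordIso_symmetric unfolding Omega1_def by blast
  then show False
    using cardSuc_greater[OF natLeq_Card_order] not_ordLess_ordLeq by blast
qed

text \<open>Closing \<open>A\<close> downwards gives a countable union of countable sets, which
  cannot exhaust the uncountable field; by totality, any element outside it lies strictly above all
  of \<open>A\<close>. This is the regularity of \<Omega>.\<close>

lemma Omega1_countable_bounded:
  assumes "r =o Omega1" "countable A" "A \<subseteq> Field r"
  obtains b where "b \<in> Field r" "\<And>a. a \<in> A \<Longrightarrow> a \<in> underS r b"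
proof -
  have wo: "wo_rel r"
    using assms(1) unfolding wo_rel_def ordIso_def by blast
  let ?U = "A \<union> (\<Union>a\<in>A. underS r a)"
  have "countable ?U"
    using assms(2,3) Omega1_countable_underS[OF assms(1)]
    by (intro countable_Un countable_UN) auto
  then have "\<not> Field r \<subseteq> ?U"
    using Omega1_uncountable_Field[OF assms(1)] countable_subset by blast
  then obtain b where b: "b \<in> Field r" "b \<notin> ?U"
    by blast
  have "a \<in> underS r b" if "a \<in> A" for a
  proof -
    have "(a, b) \<in> r \<or> (b, a) \<in> r"
      using wo_rel.TOTALS[OF wo] b(1) that assms(3) by blast
    then show ?thesis
      using b that unfolding underS_def by blast
  qed
  then show ?thesis
    using that b(1) by blast
qed

section \<open>Successors and suprema of sequences in a well-order\<close>

context wo_rel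
begin

lemma underS_trans:
  assumes "a \<in> underS b" "b \<in> underS c"
  shows "a \<in> underS c"
  using assms TRANS ANTISYM unfolding underS_def trans_def antisym_def by blast

lemma underS_asym:
  assumes "a \<in> underS b"
  shows "b \<notin> underS a"
  using assms ANTISYM unfolding underS_def antisym_def by blast

lemma underS_le_trans:
  assumes "a \<in> underS b" "(b, c) \<in> r"
  shows "a \<in> underS c"
  using assms TRANS ANTISYM unfolding underS_def trans_def antisym_def by blast

lemma le_underS_trans:
  assumes "(a, b) \<in> r" "b \<in> underS c"
  shows "a \<in> underS c"
  using assms TRANS ANTISYM unfolding underS_def trans_def antisym_def by blast

lemma not_underS_iff:
  assumes "a \<in> Field r" "b \<in> Field r"
  shows "a \<notin> underS b \<longleftrightarrow> (b, a) \<in> r"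
  using assms TOTALS ANTISYM REFL unfolding underS_def antisym_def refl_on_def by blast

lemma ord_succ_le:
  assumes "a \<in> underS b"
  shows "(ord_succ r a, b) \<in> r"
proof -
  have "b \<in> AboveS {a}"
    using assms unfolding AboveS_def underS_def by (auto intro: FieldI2)
  then show ?thesis
    unfolding ord_succ_def by (rule suc_least_AboveS)
qed

lemma ord_succ_Field_greater:
  assumes "aboveS a \<noteq> {}"
  shows "ord_succ r a \<in> Field r" "a \<in> underS (ord_succ r a)"
proof -
  have "AboveS {a} \<noteq> {}" "{a} \<subseteq> Field r"
    using assms unfolding AboveS_def aboveS_def by (auto intro: FieldI1 FieldI2)
  then show "ord_succ r a \<in> Field r" "a \<in> underS (ord_succ r a)"
    using suc_inField[of "{a}"] suc_greater[of "{a}" a]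
    unfolding ord_succ_def underS_def by auto
qed

lemma seq_with_sup_Field:
  assumes "seq_with_sup r e \<eta>"
  shows "\<eta> \<in> Field r"
  using assms unfolding seq_with_sup_def isMinim_def Above_def by blast

lemma seq_with_sup_below:
  assumes "seq_with_sup r e \<eta>"
  shows "e x \<in> underS \<eta>"
proof -
  have "e x \<in> underS (e (Suc x))" "(e (Suc x), \<eta>) \<in> r"
    using assms unfolding seq_with_sup_def isMinim_def Above_def by auto
  then show ?thesis
    by (rule underS_le_trans)
qed

lemma seq_with_sup_cofinal:
  assumes "seq_with_sup r e \<eta>" "\<beta> \<in> underS \<eta>"
  obtains x where "\<beta> \<in> underS (e x)"
proof -
  have F: "\<beta> \<in> Field r" "\<eta> \<in> Field r"
    using assms(2) unfolding underS_def by (auto intro: FieldI1 FieldI2)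
  have "\<beta> \<notin> Above (range e)"
    using assms not_underS_iff[OF F] unfolding seq_with_sup_def isMinim_def by blast
  then obtain x where "(e x, \<beta>) \<notin> r"
    using F unfolding Above_def by blast
  moreover have "e x \<in> Field r"
    using assms(1) unfolding seq_with_sup_def by blast
  ultimately show ?thesis
    using not_underS_iff[of \<beta> "e x"] F that by blast
qed

text \<open>If \<eta> were the successor of \<alpha>, cofinality would give a term above \<alpha>,
  hence at least \<eta>, although every term lies strictly below \<eta>. This serves to recognise as
  a limit an ordinal that is built as the supremum of some other sequence.\<close>

lemma limit_below_sup:
  assumes sup: "seq_with_sup r e \<eta>"
  shows "limit_below r \<eta>"
proof -
  have "\<eta> \<noteq> ord_zero r"
  proof
    assume "\<eta> = ord_zero r"
    moreover have "e 0 \<in> Field r"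
      using sup unfolding seq_with_sup_def by blast
    ultimately have "(\<eta>, e 0) \<in> r"
      unfolding ord_zero_def using minim_least by blast
    then show False
      using seq_with_sup_below[OF sup, of 0] le_underS_trans unfolding underS_def by blast
  qed
  moreover have False if "aboveS \<alpha> \<noteq> {}" "\<eta> = ord_succ r \<alpha>" for \<alpha>
  proof -
    have "\<alpha> \<in> underS \<eta>"
      using ord_succ_Field_greater that by blast
    then obtain x where "\<alpha> \<in> underS (e x)"
      using seq_with_sup_cofinal[OF sup] by blast
    then have "(\<eta>, e x) \<in> r"
      using ord_succ_le that by blast
    then show False
      using seq_with_sup_below[OF sup, of x] le_underS_trans unfolding underS_def by blast
  qed
  ultimately show ?thesis
    using seq_with_sup_Field[OF sup] unfolding limit_below_def by blast
qed

lemma wo_cases [consumes 1, case_names zero succ limit]: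
  assumes "\<eta> \<in> Field r"
  obtains "\<eta> = ord_zero r"
  | \<alpha> where "\<alpha> \<in> Field r" "\<alpha> \<in> underS \<eta>" "\<eta> = ord_succ r \<alpha>"
  | "limit_below r \<eta>"
  using assms ord_succ_Field_greater(2) unfolding limit_below_def by blast

text \<open>Isolates the part that concerns ordinals only: the functions enter through
  \<open>nest\<close> alone, which the theorem derives from their ranges.\<close>

lemma not_Omega1_if_nested_fundamental_sequences:
  assumes seq: "\<And>\<eta>. limit_below r \<eta> \<Longrightarrow> seq_with_sup r (fs \<eta>) \<eta>"
    and nest: "\<And>\<eta> \<theta> n. \<lbrakk>limit_below r \<eta>; limit_below r \<theta>; n \<ge> 1; fs \<eta> n = fs \<theta> n\<rbrakk>
                 \<Longrightarrow> fs \<theta> (Suc n) \<in> underS \<eta>"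
  shows "\<not> r =o Omega1"
proof
  assume iso: "r =o Omega1"
  define S where "S \<alpha> = {\<eta>. limit_below r \<eta> \<and> fs \<eta> 1 = \<alpha>}" for \<alpha>
  have Field_fs: "fs \<eta> n \<in> Field r" if "limit_below r \<eta>" for \<eta> n
    using seq[OF that] unfolding seq_with_sup_def by blast
  \<comment> \<open>The index starts at 1, where \<open>S\<close> fixes the term and from where on
    \<open>nest\<close> applies.\<close>
  have countable_fs: "countable ((\<lambda>\<eta>. fs \<eta> (Suc n)) ` S \<alpha>)" for n \<alpha>
  proof (induction n)
    case 0
    have "(\<lambda>\<eta>. fs \<eta> (Suc 0)) ` S \<alpha> \<subseteq> {\<alpha>}"
      unfolding S_def by auto
    then show ?case
      by (rule countable_subset) simp
  next
    case (Suc n)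
    let ?N = "(\<lambda>\<eta>. fs \<eta> (Suc n)) ` S \<alpha>"
    \<comment> \<open>One representative limit \<open>m \<beta>\<close> for each \<beta> is enough:
      by \<open>nest\<close> it bounds the next term of every \<theta> whose sequence has \<beta> at
      this index.\<close>
    have "\<forall>\<beta>\<in>?N. \<exists>\<eta>. \<eta> \<in> S \<alpha> \<and> fs \<eta> (Suc n) = \<beta>"
      by blast
    then obtain m where m: "\<And>\<beta>. \<beta> \<in> ?N \<Longrightarrow> m \<beta> \<in> S \<alpha> \<and> fs (m \<beta>) (Suc n) = \<beta>"
      by metis
    have "fs \<theta> (Suc (Suc n)) \<in> (\<Union>\<beta>\<in>?N. underS (m \<beta>))" if "\<theta> \<in> S \<alpha>" for \<theta>
    proof
      show N: "fs \<theta> (Suc n) \<in> ?N"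
        using that by blast
      show "fs \<theta> (Suc (Suc n)) \<in> underS (m (fs \<theta> (Suc n)))"
        using m[OF N] that by (intro nest) (auto simp: S_def)
    qed
    then have "(\<lambda>\<eta>. fs \<eta> (Suc (Suc n))) ` S \<alpha> \<subseteq> (\<Union>\<beta>\<in>?N. underS (m \<beta>))"
      by blast
    moreover have "countable (\<Union>\<beta>\<in>?N. underS (m \<beta>))"
    proof (rule countable_UN[OF Suc.IH])
      fix \<beta> assume "\<beta> \<in> ?N"
      then have "m \<beta> \<in> Field r"
        using m seq_with_sup_Field seq unfolding S_def by blast
      then show "countable (underS (m \<beta>))"
        by (rule Omega1_countable_underS[OF iso])
    qed
    ultimately show ?case
      by (rule countable_subset)
  qed
  have countable_S: "countable (S \<alpha>)" for \<alpha>
  proof -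
    let ?N = "\<Union>n. (\<lambda>\<eta>. fs \<eta> (Suc n)) ` S \<alpha>"
    have "countable ?N" "?N \<subseteq> Field r"
      using countable_fs Field_fs by (auto simp: S_def)
    then obtain b where b: "b \<in> Field r" "\<And>a. a \<in> ?N \<Longrightarrow> a \<in> underS b"
      using Omega1_countable_bounded[OF iso] by metis
    \<comment> \<open>The argument below gives only \<eta> \<le> b; the strict bound
      \<open>c\<close> puts all these limits into the countable set \<open>underS c\<close>.\<close>
    obtain c where c: "c \<in> Field r" "b \<in> underS c"
      using Omega1_countable_bounded[OF iso, of "{b}"] b(1) by auto
    have "\<eta> \<in> underS c" if "\<eta> \<in> S \<alpha>" for \<eta>
    proof -
      have lim: "limit_below r \<eta>"
        using that unfolding S_def by blast
      have "b \<notin> underS \<eta>"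
      proof
        assume "b \<in> underS \<eta>"
        then obtain x where "b \<in> underS (fs \<eta> x)"
          using seq_with_sup_cofinal[OF seq[OF lim]] by blast
        \<comment> \<open>Passing to \<open>Suc x\<close> covers the case x = 0, since
          \<open>?N\<close> collects only terms of positive index.\<close>
        moreover have "fs \<eta> x \<in> underS (fs \<eta> (Suc x))"
          using seq[OF lim] unfolding seq_with_sup_def by blast
        moreover have "fs \<eta> (Suc x) \<in> underS b"
          using b(2) that by blast
        ultimately show False
          using underS_trans underS_asym by blast
      qed
      then show ?thesis
        using not_underS_iff[OF b(1) seq_with_sup_Field[OF seq[OF lim]]] c(2)
          le_underS_trans by blast
    qed
    then have "S \<alpha> \<subseteq> underS c"
      by blast
    then show ?thesis
      using Omega1_countable_underS[OF iso c(1)] by (rule countable_subset)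
  qed
  \<comment> \<open>One closing-off step: \<open>b\<close> lies above every limit whose term of
    index 1 is below \<open>a\<close>. Only countably many \<alpha> are below \<open>a\<close>, each
    with a countable \<open>S \<alpha>\<close>.\<close>
  have step: "\<exists>b. b \<in> Field r \<and> a \<in> underS b \<and> (\<forall>\<alpha>\<in>underS a. \<forall>\<eta>\<in>S \<alpha>. \<eta> \<in> underS b)"
    if "a \<in> Field r" for a
  proof -
    let ?A = "insert a (\<Union>\<alpha>\<in>underS a. S \<alpha>)"
    have "countable ?A"
      using countable_S Omega1_countable_underS[OF iso that]
      by (intro countable_insert countable_UN) auto
    moreover have "?A \<subseteq> Field r"
      using that seq_with_sup_Field seq unfolding S_def by blast
    ultimately obtain b where "b \<in> Field r" "\<And>x. x \<in> ?A \<Longrightarrow> x \<in> underS b"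
      using Omega1_countable_bounded[OF iso, of ?A] by blast
    then show ?thesis
      by blast
  qed
  have ex: "\<exists>a. a \<in> Field r"
    using Omega1_uncountable_Field[OF iso] by (metis countable_empty equals0I)
  have "\<exists>\<rho>. \<forall>k. \<rho> k \<in> Field r \<and> \<rho> k \<in> underS (\<rho> (Suc k)) \<and>
      (\<forall>\<alpha>\<in>underS (\<rho> k). \<forall>\<eta>\<in>S \<alpha>. \<eta> \<in> underS (\<rho> (Suc k)))"
    using dependent_nat_choice[of "\<lambda>_ a. a \<in> Field r"
        "\<lambda>_ a b. a \<in> underS b \<and> (\<forall>\<alpha>\<in>underS a. \<forall>\<eta>\<in>S \<alpha>. \<eta> \<in> underS b)", OF ex step]
    by simp
  then obtain \<rho> where \<rho>: "\<And>k. \<rho> k \<in> Field r"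
    and \<rho>_Suc: "\<And>k. \<rho> k \<in> underS (\<rho> (Suc k))"
    and close: "\<And>k \<alpha> \<eta>. \<alpha> \<in> underS (\<rho> k) \<Longrightarrow> \<eta> \<in> S \<alpha> \<Longrightarrow> \<eta> \<in> underS (\<rho> (Suc k))"
    by blast
  have mono: "\<rho> x \<in> underS (\<rho> y)" if "x < y" for x y
    using that by (induction rule: less_Suc_induct) (use \<rho>_Suc underS_trans in blast)+
  have "countable (range \<rho>)" "range \<rho> \<subseteq> Field r"
    using \<rho> by auto
  then obtain b where "b \<in> Field r" "\<And>a. a \<in> range \<rho> \<Longrightarrow> a \<in> underS b"
    using Omega1_countable_bounded[OF iso] by metis
  then have "b \<in> Above (range \<rho>)"
    unfolding Above_def underS_def by blast
  then obtain \<delta> where "isMinim (Above (range \<rho>)) \<delta>"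
    using Well_order_isMinim_exists[of "Above (range \<rho>)"] unfolding Above_def by blast
  then have sup: "seq_with_sup r \<rho> \<delta>"
    using \<rho> mono unfolding seq_with_sup_def by blast
  have lim: "limit_below r \<delta>"
    using sup by (rule limit_below_sup)
  \<comment> \<open>The sequence \<open>fs \<delta>\<close> may differ from \<open>\<rho>\<close>,
    but its term of index 1 lies below \<delta>, hence below some \<open>\<rho> k\<close>. Then
    \<open>close\<close> applies to \<delta> itself.\<close>
  obtain k where "fs \<delta> 1 \<in> underS (\<rho> k)"
    using seq_with_sup_cofinal[OF sup seq_with_sup_below[OF seq[OF lim]]] by blast
  then have "\<delta> \<in> underS (\<rho> (Suc k))"
    using close lim unfolding S_def by blast
  then show False
    using seq_with_sup_below[OF sup, of "Suc k"] underS_asym by blast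
qed

end

section \<open>Ranges of the functions and nesting of the assigned sequences\<close>

theorem theorem2:
  fixes r :: "'a rel"
    and f :: "'a \<Rightarrow> nat \<Rightarrow> nat"
    and fs :: "'a \<Rightarrow> nat \<Rightarrow> 'a"
  assumes lim: "limit_ordinal r"
    and le_Omega: "r \<le>o Omega1"
    and pos: "\<And>\<eta>. \<eta> \<in> Field r \<Longrightarrow> pos_strict_mono (f \<eta>)"
    and zero: "\<And>x. x \<ge> 1 \<Longrightarrow> f (ord_zero r) x = 2 ^ x"
    and succ: "\<And>\<eta> \<eta>' x. \<eta> \<in> Field r \<Longrightarrow> \<eta>' \<in> Field r \<Longrightarrow> \<eta> = ord_succ r \<eta>' \<Longrightarrow> x \<ge> 1
                 \<Longrightarrow> f \<eta> x = f \<eta>' (f \<eta>' x)"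
    and limit_seq: "\<And>\<eta>. limit_below r \<eta> \<Longrightarrow> seq_with_sup r (fs \<eta>) \<eta>"
    and limit_arrow: "\<And>\<eta> x. limit_below r \<eta> \<Longrightarrow> arrow r f (ord_succ r (fs \<eta> x)) (fs \<eta> (x + 1))"
    and limit_val: "\<And>\<eta> x. limit_below r \<eta> \<Longrightarrow> x \<ge> 1 \<Longrightarrow> f \<eta> x = f (fs \<eta> x) 1"
  shows "r <o Omega1"
proof -
  have wo: "wo_rel r" and unbounded: "\<And>\<alpha>. \<alpha> \<in> Field r \<Longrightarrow> aboveS r \<alpha> \<noteq> {}"
    using lim unfolding limit_ordinal_def wo_rel_def by auto
  interpret wo_rel r by (rule wo)
  have succ_Field: "ord_succ r \<alpha> \<in> Field r" if "\<alpha> \<in> Field r" for \<alpha>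
    using ord_succ_Field_greater(1) unbounded that by blast
  have mono: "f \<eta> x < f \<eta> y" if "\<eta> \<in> Field r" "1 \<le> x" "x < y" for \<eta> x y
    using pos[OF that(1)] that unfolding pos_strict_mono_def
    by (auto intro: strict_mono_onD)
  have ge1: "1 \<le> f \<eta> x" if "\<eta> \<in> Field r" "1 \<le> x" for \<eta> x
    using pos[OF that(1)] that unfolding pos_strict_mono_def pos_range_def by auto
  have mono_le: "f \<eta> x \<le> f \<eta> y" if "\<eta> \<in> Field r" "1 \<le> x" "x \<le> y" for \<eta> x y
    using mono[OF that(1,2), of y] that(3) by (cases "x = y") auto
  \<comment> \<open>The value is 2 at zero, passing to a successor does not lower the value at 1,
    and a limit takes over the value from its term of index 1. Exceeding 1 is what makes a second
    application of the function strictly increase the value.\<close>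
  have ge2: "2 \<le> f \<eta> 1" if "\<eta> \<in> Field r" for \<eta>
    using that
  proof (induction \<eta> rule: well_order_induct)
    case (1 \<eta>)
    have IH: "2 \<le> f \<beta> 1" if "\<beta> \<in> underS \<eta>" for \<beta>
      using 1(1) that unfolding underS_def by (auto intro: FieldI1)
    from 1(2) show ?case
    proof (cases rule: wo_cases)
      case zero
      then show ?thesis
        using assms(4)[of 1] by simp
    next
      case (succ \<alpha>)
      then have "f \<eta> 1 = f \<alpha> (f \<alpha> 1)"
        using assms(5)[of \<eta> \<alpha> 1] 1(2) by simp
      moreover have "f \<alpha> 1 \<le> f \<alpha> (f \<alpha> 1)"
        using mono_le ge1 succ by simp
      ultimately show ?thesis
        using IH[OF succ(2)] by simp
    next
      case limit
      then show ?thesis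
        using IH[OF seq_with_sup_below[OF limit_seq[OF limit], of 1]] limit_val by simp
    qed
  qed
  have nest: "fs \<theta> (Suc n) \<in> underS \<eta>"
    if \<eta>: "limit_below r \<eta>" and \<theta>: "limit_below r \<theta>" and n: "n \<ge> 1"
      and eq: "fs \<eta> n = fs \<theta> n" for \<eta> \<theta> n
  proof (rule ccontr)
    assume "fs \<theta> (Suc n) \<notin> underS \<eta>"
    moreover have "\<eta> \<in> Field r" "fs \<theta> (Suc n) \<in> Field r"
      using \<eta> limit_seq[OF \<theta>] unfolding limit_below_def seq_with_sup_def by auto
    ultimately have le: "\<eta> \<in> under (fs \<theta> (Suc n))"
      using not_underS_iff unfolding under_def by blast
    let ?\<alpha> = "fs \<eta> n"
    have \<alpha>: "?\<alpha> \<in> Field r" "?\<alpha> \<in> underS \<eta>"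
      using limit_seq[OF \<eta>] seq_with_sup_below unfolding seq_with_sup_def by auto
    \<comment> \<open>The arrow speaks only of ordinals strictly above
      \<open>ord_succ r ?\<alpha>\<close>; \<eta> is one of them because it is a limit above
      \<open>?\<alpha>\<close>.\<close>
    have "\<eta> \<noteq> ord_succ r ?\<alpha>"
      using \<eta> \<alpha>(1) unbounded unfolding limit_below_def by blast
    then have "\<eta> \<in> aboveS (ord_succ r ?\<alpha>)"
      using ord_succ_le[OF \<alpha>(2)] unfolding aboveS_def by blast
    \<comment> \<open>As \<open>fs \<theta> n\<close> is also \<open>?\<alpha>\<close>, the arrow
      belonging to \<theta> constrains the range of \<open>f \<eta>\<close>.\<close>
    then have "pos_range (f \<eta>) \<subseteq> pos_range (f (ord_succ r ?\<alpha>))"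
      using limit_arrow[OF \<theta>, of n] le eq unfolding arrow_def by auto
    moreover have "f ?\<alpha> 1 \<in> pos_range (f \<eta>)"
      using limit_val[OF \<eta> n] n unfolding pos_range_def by force
    ultimately obtain x where x: "x \<ge> 1" "f ?\<alpha> 1 = f (ord_succ r ?\<alpha>) x"
      unfolding pos_range_def by auto
    \<comment> \<open>The second iterate of \<open>f ?\<alpha>\<close> is smallest at 1, and already
      there it exceeds \<open>f ?\<alpha> 1\<close>.\<close>
    have "f ?\<alpha> 1 < f ?\<alpha> (f ?\<alpha> 1)"
      using mono[OF \<alpha>(1), of 1] ge2[OF \<alpha>(1)] by simp
    also have "\<dots> \<le> f ?\<alpha> (f ?\<alpha> x)"
      using mono_le[OF \<alpha>(1)] ge1[OF \<alpha>(1)] x(1) by simp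
    also have "\<dots> = f (ord_succ r ?\<alpha>) x"
      using succ[OF succ_Field[OF \<alpha>(1)] \<alpha>(1) refl x(1)] by simp
    finally show False
      using x(2) by simp
  qed
  have "\<not> r =o Omega1"
    using limit_seq nest by (rule not_Omega1_if_nested_fundamental_sequences)
  then show ?thesis
    using le_Omega ordLeq_iff_ordLess_or_ordIso by blast
qed

end
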